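(* Let $d\ge 1$ be a natural number and let $A$ and $B$ be subsets of $\mathbb{Z}^{d}$ such that $\overline{\operatorname{d}}(A)=\alpha>0$ and $\operatorname{BD}(B)>0$. Then $A+B$ is upper syndetic of level $\alpha$.
   Context: Intervals denote intervals of integers, $\mathbb{N}$ does not contain $0$, and $A+B=\{a+b:a\in A,b\in B\}$. For $A\subseteq\mathbb{Z}^d$, the upper (asymptotic) density is $\overline{\operatorname{d}}(A)=\limsup_{n\to\infty}\frac{|A\cap[-n,n]^d|}{(2n+1)^d}$, and the (upper) Banach density is $\operatorname{BD}(A)=\lim_{n\to\infty}\sup_{x\in\mathbb{Z}^d}\frac{|A\cap(x+[-n,n]^d)|}{(2n+1)^d}$. For a real number $0<\alpha\le 1$, a set $C\subseteq\mathbb{Z}^d$ is upper syndetic of level $\alpha$ if there exists a natural number $m$ (with $m=0$ allowed) such that for all $k\in\mathbb{N}$, $\overline{\operatorname{d}}(\{z\in\mathbb{Z}^d: z+[-k,k]^d\subseteq C+[-m,m]^d\})\ge\alpha$. *)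

theory Defs
  imports "HOL-Analysis.Analysis" "HOL-Library.Set_Algebras"
begin

text \<open>
  \<open>\<int>\<^sup>d\<close> is rendered as \<open>int ^ 'd\<close> with \<open>d = CARD('d) \<ge> 1\<close>. Sumsets are the pointwise sums
  \<open>A + B\<close> of \<^theory>\<open>HOL-Library.Set_Algebras\<close>. Densities are \<^typ>\<open>ereal\<close>-valued, so that
  \<open>limsup\<close> and suprema are taken in a complete lattice; all values lie in \<open>[0, 1]\<close>.
\<close>

definition cube :: "nat \<Rightarrow> (int ^ 'd) set" where
  "cube n = {z. \<forall>i. z $ i \<in> {- int n..int n}}"

definition upper_density :: "(int ^ 'd) set \<Rightarrow> ereal" where
  "upper_density A =
     limsup (\<lambda>n. ereal (real (card (A \<inter> cube n)) / real ((2 * n + 1) ^ CARD('d))))"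

text \<open>The limit below exists for every set: tile a large cube by translates of a small one.\<close>

definition banach_density :: "(int ^ 'd) set \<Rightarrow> ereal" where
  "banach_density A =
     lim (\<lambda>n. SUP x. ereal (real (card (A \<inter> (+) x ` cube n)) / real ((2 * n + 1) ^ CARD('d))))"

definition upper_syndetic :: "real \<Rightarrow> (int ^ 'd) set \<Rightarrow> bool" where
  "upper_syndetic \<alpha> C \<longleftrightarrow> 0 < \<alpha> \<and> \<alpha> \<le> 1 \<and>
     (\<exists>m. \<forall>k\<ge>1. upper_density {z. (+) z ` cube k \<subseteq> C + cube m} \<ge> ereal \<alpha>)"

end

theory Submission
  imports Defs "HOL-Real_Asymp.Real_Asymp"
begin

text \<open>
  If some \<open>A + cube m\<close> has density \<open>a > \<alpha>\<close>, there is room to lose \<open>3 * e = a - \<alpha>\<close>. A fattening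
  \<open>B + cube m'\<close> has density at least \<open>1 - e\<close> in arbitrarily large windows, so a point
  is missed by \<open>(A + cube m) + (B + cube m')\<close> only if \<open>A + cube m\<close> is sparse in a large window
  around (a translate of) it; averaging bounds the density of such points. Otherwise every fattening of
  \<open>A\<close> has density \<open>\<alpha>\<close>, so along suitable cubes \<open>(A + cube k) - A\<close> has density \<open>0\<close> and
  \<open>A\<close> itself contains \<open>z + cube k\<close> for almost all \<open>z \<in> A\<close>.
\<close>

section \<open>Volumes of cubes and the cost of changing the radius\<close>

definition vol :: "nat \<Rightarrow> nat \<Rightarrow> real" where
  "vol d n = real ((2 * n + 1) ^ d)"

lemma vol_pos: "vol d n > 0"
  by (simp add: vol_def)

text \<open>For fixed \<open>K\<close> the ratio of the two volumes tends to 1. Any strict gap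
  between \<open>a\<close> and \<open>b\<close> therefore absorbs a boundary layer of fixed
  width.\<close>

lemma eventually_vol_shift_less:
  assumes "a < b"
  shows "\<forall>\<^sub>F n in sequentially. a * vol d (n + K) < b * vol d n"
proof -
  have "(\<lambda>n. (2 * real (n + K) + 1) / (2 * real n + 1)) \<longlonglongrightarrow> 1"
    by real_asymp
  then have "(\<lambda>n. a * ((2 * real (n + K) + 1) / (2 * real n + 1)) ^ d) \<longlonglongrightarrow> a * 1 ^ d"
    by (intro tendsto_intros)
  then have "\<forall>\<^sub>F n in sequentially. a * ((2 * real (n + K) + 1) / (2 * real n + 1)) ^ d < b"
    using assms by (intro order_tendstoD) auto
  then show ?thesis
  proof eventually_elim
    case (elim n)
    have "vol d n = (2 * real n + 1) ^ d" "vol d (n + K) = (2 * real (n + K) + 1) ^ d"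
      by (simp_all add: vol_def add.commute)
    then show ?case
      using elim vol_pos[of d n] by (simp only: power_divide) (simp add: pos_divide_less_eq)
  qed
qed

lemma frequently_sequentially_seg:
  "(\<exists>\<^sub>F n in sequentially. P (n + k)) \<longleftrightarrow> (\<exists>\<^sub>F n in sequentially. P n)"
  unfolding frequently_def using eventually_sequentially_seg[of "\<lambda>n. \<not> P n" k] by simp

subsection \<open>Cubes\<close>

lemma cube_eq_image: "(cube n :: (int ^ 'd) set) = vec_lambda ` (PiE UNIV (\<lambda>_. {- int n..int n}))"
proof (intro equalityI subsetI)
  fix z :: "int ^ 'd" assume "z \<in> cube n"
  then have "z = vec_lambda (vec_nth z)" "vec_nth z \<in> PiE UNIV (\<lambda>_. {- int n..int n})"
    by (auto simp: cube_def PiE_def)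
  then show "z \<in> vec_lambda ` (PiE UNIV (\<lambda>_. {- int n..int n}))" by blast
qed (auto simp: cube_def PiE_def Pi_def)

lemma finite_cube [simp]: "finite (cube n :: (int ^ 'd) set)"
  unfolding cube_eq_image by (intro finite_imageI finite_PiE) auto

lemma card_cube: "real (card (cube n :: (int ^ 'd) set)) = vol CARD('d) n"
proof -
  have "inj_on vec_lambda (PiE UNIV (\<lambda>_. {- int n..int n}) :: ('d \<Rightarrow> int) set)"
    by (auto simp: inj_on_def vec_lambda_inject)
  then have "card (cube n :: (int ^ 'd) set)
      = card (PiE UNIV (\<lambda>_. {- int n..int n}) :: ('d \<Rightarrow> int) set)"
    unfolding cube_eq_image by (rule card_image)
  also have "\<dots> = (2 * n + 1) ^ CARD('d)"
  proof -
    have "card {- int n..int n} = 2 * n + 1" by simp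
    then show ?thesis by (simp only: card_PiE[OF finite] prod_constant)
  qed
  finally show ?thesis by (simp add: vol_def)
qed

lemma zero_in_cube: "0 \<in> cube n"
  by (simp add: cube_def)

lemma uminus_in_cube: "z \<in> cube n \<Longrightarrow> - z \<in> cube n"
  by (simp add: cube_def minus_le_iff)

lemma add_in_cube: "y \<in> cube m \<Longrightarrow> z \<in> cube n \<Longrightarrow> y + z \<in> cube (m + n)"
  by (simp add: cube_def) (smt (verit))

lemma cube_mono: "m \<le> n \<Longrightarrow> cube m \<subseteq> cube n"
  by (simp add: cube_def subset_iff) (smt (verit) of_nat_mono)

lemma ex_in_cube: "\<exists>L. x \<in> cube L"
proof -
  have "x \<in> cube (nat (Max (range (\<lambda>i. \<bar>x $ i\<bar>))))"
  proof -
    have "\<bar>x $ i\<bar> \<le> Max (range (\<lambda>i. \<bar>x $ i\<bar>))" for i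
      by (intro Max_ge) auto
    then have "\<bar>x $ i\<bar> \<le> int (nat (Max (range (\<lambda>i. \<bar>x $ i\<bar>))))" for i
      by (smt (verit) int_nat_eq)
    then show ?thesis unfolding cube_def by (auto simp: abs_le_iff minus_le_iff)
  qed
  then show ?thesis by blast
qed

lemma in_translate_iff: "y \<in> (+) x ` S \<longleftrightarrow> y - x \<in> S" for x :: "'a::ab_group_add"
proof
  assume "y - x \<in> S"
  then show "y \<in> (+) x ` S" by (intro image_eqI[of _ _ "y - x"]) auto
qed auto

lemma card_window: "real (card ((+) x ` cube n :: (int ^ 'd) set)) = vol CARD('d) n"
  by (simp add: card_image card_cube)

lemma card_Int_window_le: "real (card (S \<inter> (+) x ` cube n :: (int ^ 'd) set)) \<le> vol CARD('d) n"
proof -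
  have "card (S \<inter> (+) x ` cube n) \<le> card ((+) x ` cube n)" by (intro card_mono) auto
  then show ?thesis by (metis card_window of_nat_le_iff)
qed

lemma subset_plus_cube: "S \<subseteq> S + cube m"
  using zero_in_cube by (metis add_0_right set_plus_intro subsetI)

lemma plus_cube_plus_cube: "S + cube m + cube n \<subseteq> S + cube (m + n)"
  by (auto elim!: set_plus_elim simp: add.assoc intro!: add_in_cube)

lemma plus_cube_plus_plus_cube: "(S + cube m) + (T + cube n) \<subseteq> S + T + cube (m + n)"
proof
  fix z assume "z \<in> (S + cube m) + (T + cube n)"
  then obtain s u t v where "s \<in> S" "u \<in> cube m" "t \<in> T" "v \<in> cube n" "z = (s + u) + (t + v)"
    by (auto elim!: set_plus_elim)
  moreover have "(s + u) + (t + v) = (s + t) + (u + v)" by (simp add: algebra_simps)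
  ultimately show "z \<in> S + T + cube (m + n)"
    by (metis add_in_cube set_plus_intro)
qed

text \<open>Double counting of pairs \<open>(s, c)\<close> with \<open>c - s\<close> in
  \<open>cube M\<close>: each \<open>s\<close> in the window has \<open>vol CARD('d) M\<close> such
  centres, all within the enlarged window. The right side may also count points of \<open>S\<close>
  outside the smaller window.\<close>

lemma sum_card_windows_ge:
  fixes S :: "(int ^ 'd) set"
  shows "vol CARD('d) M * real (card (S \<inter> (+) x ` cube n))
    \<le> (\<Sum>c\<in>(+) x ` cube (n + M). real (card (S \<inter> (+) c ` cube M)))"
proof -
  let ?T = "S \<inter> (+) x ` cube n" and ?W = "(+) x ` cube (n + M)"
  have "vol CARD('d) M * real (card ?T) = (\<Sum>s\<in>?T. real (card ((+) s ` cube M)))"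
    by (simp only: card_window sum_constant mult.commute)
  also have "\<dots> = real (card (SIGMA s:?T. (+) s ` cube M))"
    by (subst card_SigmaI) auto
  also have "\<dots> \<le> real (card ((\<lambda>(c, s). (s, c)) ` (SIGMA c:?W. S \<inter> (+) c ` cube M)))"
  proof -
    have "(SIGMA s:?T. (+) s ` cube M) \<subseteq> (\<lambda>(c, s). (s, c)) ` (SIGMA c:?W. S \<inter> (+) c ` cube M)"
    proof (intro subsetI, elim SigmaE IntE, hypsubst)
      fix s c assume s: "s \<in> S" "s \<in> (+) x ` cube n" and c: "c \<in> (+) s ` cube M"
      have "c \<in> ?W"
        using add_in_cube[of "s - x" n "c - s" M] s c by (simp only: in_translate_iff) simp
      moreover have "s \<in> (+) c ` cube M"
        using uminus_in_cube[of "c - s" M] c by (simp only: in_translate_iff) simp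
      ultimately show "(s, c) \<in> (\<lambda>(c, s). (s, c)) ` (SIGMA c:?W. S \<inter> (+) c ` cube M)"
        using s by (intro image_eqI[of _ _ "(c, s)"]) auto
    qed
    then show ?thesis
      by (intro of_nat_mono card_mono) auto
  qed
  also have "\<dots> = real (card (SIGMA c:?W. S \<inter> (+) c ` cube M))"
    by (subst card_image) (auto simp: inj_on_def)
  also have "\<dots> = (\<Sum>c\<in>?W. real (card (S \<inter> (+) c ` cube M)))"
    by (subst card_SigmaI) auto
  finally show ?thesis .
qed

subsection \<open>Sets dense in large windows\<close>

text \<open>This holds for \<open>r\<close> below, and fails for \<open>r\<close> above, the limsup
  over \<open>n\<close> of the largest density in a window of radius \<open>n\<close>. It serves as
  Banach density without any appeal to convergence.\<close>

definition dense_windows :: "(int ^ 'd) set \<Rightarrow> real \<Rightarrow> bool" where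
  "dense_windows S r \<longleftrightarrow>
     (\<exists>\<^sub>F n in sequentially. \<exists>x. r * vol CARD('d) n \<le> real (card (S \<inter> (+) x ` cube n)))"

lemma dense_windows_mono:
  assumes "dense_windows S r" "S \<subseteq> T" "t \<le> r"
  shows "dense_windows T t"
  using assms(1) unfolding dense_windows_def
proof (rule frequently_elim1)
  fix n assume "\<exists>x. r * vol CARD('a) n \<le> real (card (S \<inter> (+) x ` cube n))"
  then obtain x where x: "r * vol CARD('a) n \<le> real (card (S \<inter> (+) x ` cube n))" by blast
  have "t * vol CARD('a) n \<le> r * vol CARD('a) n"
    using assms(3) vol_pos[of "CARD('a)" n] by (simp add: mult_right_mono)
  also note x
  also have "card (S \<inter> (+) x ` cube n) \<le> card (T \<inter> (+) x ` cube n)"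
    using assms(2) by (intro card_mono) auto
  finally show "\<exists>x. t * vol CARD('a) n \<le> real (card (T \<inter> (+) x ` cube n))" by auto
qed

lemma dense_windows_le_1:
  assumes "dense_windows (S :: (int ^ 'd) set) r"
  shows "r \<le> 1"
proof -
  obtain n x where "r * vol CARD('d) n \<le> real (card (S \<inter> (+) x ` cube n))"
    using frequently_ex[OF assms[unfolded dense_windows_def]] by blast
  then have "r * vol CARD('d) n \<le> 1 * vol CARD('d) n"
    using card_Int_window_le[of S x n] by linarith
  then show ?thesis
    using vol_pos by (meson mult_le_cancel_right_pos)
qed

text \<open>Convergence to 0 would make \<open>lim\<close> equal to 0. So the nonnegative suprema
  stay above some positive bound infinitely often, whether or not they converge.\<close>

lemma dense_windows_of_banach_density:
  assumes "banach_density (B :: (int ^ 'd) set) > 0"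
  obtains r where "r > 0" "dense_windows B r"
proof -
  define f where "f n = (SUP x. ereal (real (card (B \<inter> (+) x ` cube n)) / vol CARD('d) n))" for n
  have nonneg: "0 \<le> f n" for n
    unfolding f_def by (rule SUP_upper2[of 0]) (simp_all add: vol_def)
  have "\<not> f \<longlonglongrightarrow> 0"
  proof
    assume "f \<longlonglongrightarrow> 0"
    then have "lim f = 0" by (rule limI)
    then show False
      using assms by (simp add: banach_density_def f_def[abs_def] vol_def)
  qed
  then obtain e where e: "e > 0" "\<not> (\<forall>\<^sub>F n in sequentially. f n < e)"
    unfolding order_tendsto_iff using nonneg
    by (metis (no_types, lifting) always_eventually order_less_le_trans)
  obtain r where r: "0 < ereal r" "ereal r < e"
    using ereal_dense2[OF e(1)] by auto
  have "\<exists>\<^sub>F n in sequentially. e \<le> f n"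
    using e(2) by (simp add: frequently_def not_le)
  then have "dense_windows B r"
    unfolding dense_windows_def
  proof (rule frequently_elim1)
    fix n assume "e \<le> f n"
    then have "ereal r < f n" using r by (rule_tac order_less_le_trans)
    then obtain x where "ereal r < ereal (real (card (B \<inter> (+) x ` cube n)) / vol CARD('d) n)"
      unfolding f_def by (auto simp: less_SUP_iff)
    then have "r * vol CARD('d) n < real (card (B \<inter> (+) x ` cube n))"
      using vol_pos[of "CARD('d)" n] by (simp add: pos_less_divide_eq)
    then show "\<exists>x. r * vol CARD('d) n \<le> real (card (B \<inter> (+) x ` cube n))"
      by (intro exI[of _ x]) simp
  qed
  with r that show ?thesis by simp
qed

text \<open>A window of radius \<open>M\<close> meets \<open>S\<close> only if its centre lies in \<open>S + cube M\<close>, and such centres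
  have density at most \<open>s\<close>; the average density of \<open>S\<close> over the windows meeting it is
  therefore about \<open>r / s\<close> or more.\<close>

lemma dense_windows_improve:
  fixes S :: "(int ^ 'd) set"
  assumes S: "dense_windows S r" and sparse: "\<And>M. \<not> dense_windows (S + cube M) s"
    and "s > 0" "t < r / s"
  shows "dense_windows S t"
proof -
  let ?v = "vol CARD('d)"
  have "\<exists>x. t * ?v M \<le> real (card (S \<inter> (+) x ` cube M))" for M
  proof (rule ccontr)
    assume neg: "\<not> ?thesis"
    then have small: "real (card (S \<inter> (+) c ` cube M)) < t * ?v M" for c
      by (metis linorder_not_le)
    have "0 < t * ?v M" using small[of 0] by (meson of_nat_0_le_iff order_le_less_trans)
    have "\<forall>\<^sub>F n in sequentially. \<forall>x. real (card ((S + cube M) \<inter> (+) x ` cube n)) < s * ?v n"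
      using sparse[of M] by (simp add: dense_windows_def not_frequently not_le)
    then have "\<forall>\<^sub>F n in sequentially.
        \<forall>x. real (card ((S + cube M) \<inter> (+) x ` cube (n + M))) < s * ?v (n + M)"
      by (subst eventually_sequentially_seg)
    \<comment> \<open>The strict inequality \<open>t * s < r\<close> pays for passing from radius
      \<open>n\<close> to \<open>n + M\<close>.\<close>
    moreover have "\<forall>\<^sub>F n in sequentially. (t * s) * ?v (n + M) < r * ?v n"
      using assms(3,4) by (intro eventually_vol_shift_less) (simp add: pos_less_divide_eq)
    ultimately obtain n x where n:
      "real (card ((S + cube M) \<inter> (+) x ` cube (n + M))) < s * ?v (n + M)"
      "t * s * ?v (n + M) < r * ?v n"
      "r * ?v n \<le> real (card (S \<inter> (+) x ` cube n))"
      using frequently_ex[OF frequently_eventually_conj[OF S[unfolded dense_windows_def] eventually_conj]]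
      by blast
    let ?W = "(+) x ` cube (n + M)"
    have zero: "S \<inter> (+) c ` cube M = {}" if "c \<notin> S + cube M" for c
    proof (rule ccontr)
      assume "S \<inter> (+) c ` cube M \<noteq> {}"
      then obtain y where "y \<in> S" "y - c \<in> cube M"
        unfolding in_translate_iff[symmetric] by blast
      then have "y + - (y - c) \<in> S + cube M" by (intro set_plus_intro uminus_in_cube)
      then show False using that by simp
    qed
    have "?v M * (r * ?v n) \<le> ?v M * real (card (S \<inter> (+) x ` cube n))"
      using n(3) vol_pos[of "CARD('d)" M] by simp
    also have "\<dots> \<le> (\<Sum>c\<in>?W. real (card (S \<inter> (+) c ` cube M)))"
      by (rule sum_card_windows_ge)
    also have "\<dots> = (\<Sum>c\<in>(S + cube M) \<inter> ?W. real (card (S \<inter> (+) c ` cube M)))"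
      by (rule sum.mono_neutral_right) (use zero in auto)
    also have "\<dots> \<le> (\<Sum>c\<in>(S + cube M) \<inter> ?W. t * ?v M)"
      by (intro sum_mono less_imp_le small)
    also have "\<dots> = real (card ((S + cube M) \<inter> ?W)) * (t * ?v M)" by simp
    also have "\<dots> \<le> s * ?v (n + M) * (t * ?v M)"
      using n(1) \<open>0 < t * ?v M\<close> by (intro mult_right_mono) auto
    also have "\<dots> = ?v M * (t * s * ?v (n + M))" by simp
    also have "\<dots> < ?v M * (r * ?v n)"
      using n(2) vol_pos[of "CARD('d)" M] by simp
    finally show False by simp
  qed
  then show ?thesis
    unfolding dense_windows_def by (simp add: eventually_frequently)
qed

text \<open>The supremum \<open>g\<close> of the densities reached by fattenings of \<open>B\<close>
  must be 1: if it were smaller, \<open>dense_windows_improve\<close> would push a density close to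
  \<open>g\<close> beyond \<open>g\<close>.\<close>

lemma dense_windows_plus_cube:
  fixes B :: "(int ^ 'd) set"
  assumes B: "dense_windows B r" "r > 0" and e: "e > 0"
  shows "\<exists>m. dense_windows (B + cube m) (1 - e)"
proof (rule ccontr)
  assume neg: "\<not> ?thesis"
  define R where "R = {q. \<exists>m. dense_windows (B + cube m) q}"
  have rR: "r \<in> R"
    unfolding R_def using dense_windows_mono[OF B(1) subset_plus_cube] by blast
  have bdd: "bdd_above R"
    unfolding R_def bdd_above_def using dense_windows_le_1 by blast
  define g where "g = Sup R"
  have le_g: "q \<le> g" if "q \<in> R" for q
    unfolding g_def using that bdd by (rule cSup_upper)
  have "q \<le> 1 - e" if "q \<in> R" for q
  proof (rule ccontr)
    assume "\<not> q \<le> 1 - e"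
    with that neg show False
      using dense_windows_mono[OF _ order_refl, of _ q "1 - e"] by (auto simp: R_def)
  qed
  then have "g \<le> 1 - e"
    unfolding g_def using rR by (intro cSup_least) auto
  then have g: "0 < g" "g < 1" using le_g[OF rR] B(2) e by auto
  \<comment> \<open>Any \<open>s\<close> strictly between \<open>g\<close> and 1 works: no fattening
    reaches \<open>s\<close>, and \<open>g * s < g\<close> leaves room for an attained
    \<open>q\<close> with \<open>q / s > g\<close>.\<close>
  define s where "s = (g + 1) / 2"
  have s: "g < s" "s < 1" "0 < s" using g by (simp_all add: s_def)
  have "g * s < g" using g s by simp
  then obtain q where q: "q \<in> R" "g * s < q"
    unfolding g_def using rR less_cSup_iff[OF _ bdd] by auto
  obtain m where m: "dense_windows (B + cube m) q" using q by (auto simp: R_def)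
  have "g < q / s" using q s by (simp add: pos_less_divide_eq)
  then obtain t where t: "g < t" "t < q / s" using dense by blast
  have "\<not> dense_windows (B + cube m + cube M) s" for M
    using dense_windows_mono[OF _ plus_cube_plus_cube order_refl, of B m M s] le_g[of s] s
    by (auto simp: R_def)
  then have "dense_windows (B + cube m) t"
    using dense_windows_improve[OF m _ s(3) t(2)] by blast
  then show False using le_g[of t] t by (auto simp: R_def)
qed

subsection \<open>Upper density\<close>

lemma frequently_of_less_upper_density:
  fixes A :: "(int ^ 'd) set"
  assumes "ereal r < upper_density A"
  shows "\<exists>\<^sub>F n in sequentially. r * vol CARD('d) n \<le> real (card (A \<inter> cube n))"
proof (rule ccontr)
  assume "\<not> ?thesis"
  then have "\<forall>\<^sub>F n in sequentially. real (card (A \<inter> cube n)) < r * vol CARD('d) n"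
    by (simp add: not_frequently not_le)
  then have "\<forall>\<^sub>F n in sequentially.
      ereal (real (card (A \<inter> cube n)) / real ((2 * n + 1) ^ CARD('d))) \<le> ereal r"
    by eventually_elim (simp add: vol_def pos_divide_le_eq)
  then have "upper_density A \<le> ereal r"
    unfolding upper_density_def by (rule Limsup_bounded)
  with assms show False by simp
qed

lemma eventually_of_upper_density_less:
  fixes A :: "(int ^ 'd) set"
  assumes "upper_density A < ereal r"
  shows "\<forall>\<^sub>F n in sequentially. real (card (A \<inter> cube n)) < r * vol CARD('d) n"
  using Limsup_lessD[OF assms[unfolded upper_density_def]]
  by eventually_elim (simp add: vol_def pos_divide_less_eq del: of_nat_power)

text \<open>Counting in the larger cube but normalising by the smaller one is harmless in the limit.
  Fixed translations and boundary layers can thus be ignored, and \<open>K\<close> may depend on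
  \<open>r\<close>.\<close>

lemma upper_density_geI:
  fixes G :: "(int ^ 'd) set"
  assumes "\<And>r. r < a \<Longrightarrow>
    \<exists>K. \<exists>\<^sub>F n in sequentially. r * vol CARD('d) n \<le> real (card (G \<inter> cube (n + K)))"
  shows "ereal a \<le> upper_density G"
proof (rule ccontr)
  assume "\<not> ?thesis"
  then obtain q where q: "upper_density G < ereal q" "ereal q < ereal a"
    using ereal_dense2[of "upper_density G" "ereal a"] unfolding not_le by blast
  obtain r where r: "q < r" "r < a" using q dense by auto
  obtain K where K: "\<exists>\<^sub>F n in sequentially. r * vol CARD('d) n \<le> real (card (G \<inter> cube (n + K)))"
    using assms[OF r(2)] by blast
  have "\<forall>\<^sub>F n in sequentially. real (card (G \<inter> cube (n + K))) < q * vol CARD('d) (n + K)"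
    using eventually_of_upper_density_less[OF q(1)]
    by (subst eventually_sequentially_seg)
  then have "\<forall>\<^sub>F n in sequentially. \<not> r * vol CARD('d) n \<le> real (card (G \<inter> cube (n + K)))"
    using eventually_vol_shift_less[OF r(1), of "CARD('d)" K] by eventually_elim simp
  with K show False by (simp add: frequently_def)
qed

lemma upper_density_le_1: "upper_density (A :: (int ^ 'd) set) \<le> 1"
  unfolding upper_density_def
proof (rule Limsup_bounded, rule always_eventually, rule allI)
  fix n
  have "real (card (A \<inter> cube n)) \<le> vol CARD('d) n"
    using card_Int_window_le[of A 0 n] by simp
  then show "ereal (real (card (A \<inter> cube n)) / real ((2 * n + 1) ^ CARD('d))) \<le> 1"
    by (simp add: vol_def pos_divide_le_eq)
qed

subsection \<open>Sums with dense sets\<close>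

text \<open>If \<open>c + cube k\<close> is not covered by \<open>A + S\<close>, then \<open>A\<close> has density about \<open>e\<close> at most
  in a window around \<open>c - x\<close>, where \<open>x\<close> is the centre of a window in which \<open>S\<close> has
  density \<open>1 - e\<close>. Averaging over \<open>c\<close> bounds the density of such \<open>c\<close>.\<close>

lemma frequently_cubes_in_sum:
  fixes A S :: "(int ^ 'd) set"
  assumes A: "\<exists>\<^sub>F n in sequentially. a * vol CARD('d) n \<le> real (card (A \<inter> cube n))"
    and S: "dense_windows S (1 - e)" and "e > 0"
  shows "\<exists>K. \<exists>\<^sub>F n in sequentially. (a - 3 * e) * vol CARD('d) n
    \<le> real (card ({z. (+) z ` cube k \<subseteq> A + S} \<inter> cube (n + K)))"
proof -
  let ?v = "vol CARD('d)"
  define G where "G = {z. (+) z ` cube k \<subseteq> A + S}"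
  \<comment> \<open>Radius \<open>M + k\<close> makes the window of \<open>S\<close> hold all
    reflected points \<open>x + c + y - p\<close> below. The gap from \<open>e\<close> to
    \<open>2 * e\<close> absorbs \<open>k\<close>; the one from \<open>2 * e\<close> to
    \<open>3 * e\<close> later absorbs \<open>M\<close>.\<close>
  have "\<exists>\<^sub>F M in sequentially.
      \<exists>x. (1 - e) * ?v (M + k) \<le> real (card (S \<inter> (+) x ` cube (M + k)))"
    using S unfolding dense_windows_def by (subst frequently_sequentially_seg)
  moreover have "\<forall>\<^sub>F M in sequentially. e * ?v (M + k) < 2 * e * ?v M"
    using \<open>e > 0\<close> by (intro eventually_vol_shift_less) simp
  ultimately obtain M x where x: "(1 - e) * ?v (M + k) \<le> real (card (S \<inter> (+) x ` cube (M + k)))"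
    and M: "e * ?v (M + k) < 2 * e * ?v M"
    using frequently_ex[OF frequently_eventually_conj] by blast
  obtain L where L: "x \<in> cube L" using ex_in_cube by blast
  have bad: "real (card (A \<inter> (+) c ` cube M)) \<le> 2 * e * ?v M" if notG: "x + c \<notin> G" for c
  proof -
    obtain y where y: "y \<in> cube k" "x + c + y \<notin> A + S"
      using notG unfolding G_def by blast
    let ?D = "(+) x ` cube (M + k)"
    \<comment> \<open>Reflection: if the image of \<open>p\<close> were in \<open>S\<close>, then
      \<open>x + c + y\<close> would be a sum from \<open>A + S\<close>. So this part of
      \<open>A\<close> injects into the few points of the window that \<open>S\<close>
      misses.\<close>
    have "(\<lambda>p. x + c + y - p) ` (A \<inter> (+) c ` cube M) \<subseteq> ?D - S"
    proof (intro image_subsetI, elim IntE)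
      fix p assume p: "p \<in> A" "p \<in> (+) c ` cube M"
      have "- (p - c) + y \<in> cube (M + k)"
        using p y by (intro add_in_cube uminus_in_cube) (simp_all only: in_translate_iff)
      moreover have "x + c + y - p - x = - (p - c) + y" by simp
      ultimately have "x + c + y - p \<in> ?D" by (simp only: in_translate_iff)
      moreover have "x + c + y - p \<notin> S"
        using y(2) set_plus_intro[OF p(1), of "x + c + y - p" S] by (auto simp: add.assoc)
      ultimately show "x + c + y - p \<in> ?D - S" by blast
    qed
    then have "card (A \<inter> (+) c ` cube M) \<le> card (?D - S)"
      by (intro card_inj_on_le[of "\<lambda>p. x + c + y - p"]) (auto simp: inj_on_def)
    moreover have "card ?D = card (S \<inter> ?D) + card (?D - S)"
      by (subst card_Un_disjoint[symmetric]) (auto intro!: arg_cong[of _ _ card])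
    ultimately have "real (card (A \<inter> (+) c ` cube M)) \<le> ?v (M + k) - real (card (S \<inter> ?D))"
      using card_window[of x "M + k"] by linarith
    also have "\<dots> \<le> e * ?v (M + k)" using x by (simp add: algebra_simps)
    finally show ?thesis using M by linarith
  qed
  have bound: "real (card (A \<inter> cube n)) \<le> real (card (G \<inter> cube (n + (M + L)))) + 2 * e * ?v (n + M)" for n
  proof -
    let ?W = "cube (n + M) :: (int ^ 'd) set"
    let ?H = "{c \<in> ?W. x + c \<in> G}"
    have "?v M * real (card (A \<inter> cube n)) \<le> (\<Sum>c\<in>?W. real (card (A \<inter> (+) c ` cube M)))"
      using sum_card_windows_ge[where x = 0 and S = A and n = n and M = M] by simp
    \<comment> \<open>Good centres get the trivial bound by the window volume, the others the bound
      \<open>bad\<close>.\<close>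
    also have "\<dots> \<le> (\<Sum>c\<in>?W. (if x + c \<in> G then ?v M else 0) + 2 * e * ?v M)"
    proof (intro sum_mono)
      fix c
      have "0 \<le> 2 * e * ?v M" using \<open>e > 0\<close> vol_pos[of "CARD('d)" M] by simp
      then show "real (card (A \<inter> (+) c ` cube M)) \<le> (if x + c \<in> G then ?v M else 0) + 2 * e * ?v M"
        using bad[of c] card_Int_window_le[of A c M] by auto
    qed
    also have "\<dots> = real (card ?H) * ?v M + ?v (n + M) * (2 * e * ?v M)"
      by (simp add: sum.distrib card_cube sum.inter_filter[symmetric])
    also have "\<dots> = ?v M * (real (card ?H) + 2 * e * ?v (n + M))"
      by (simp add: algebra_simps)
    finally have "real (card (A \<inter> cube n)) \<le> real (card ?H) + 2 * e * ?v (n + M)"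
      using vol_pos[of "CARD('d)" M] by simp
    moreover have "card ?H \<le> card (G \<inter> cube (n + (M + L)))"
    proof (rule card_inj_on_le[of "(+) x"])
      show "(+) x ` ?H \<subseteq> G \<inter> cube (n + (M + L))"
        using add_in_cube[OF L, of _ "n + M"] by (auto simp: ac_simps)
    qed auto
    ultimately show ?thesis by simp
  qed
  have "\<forall>\<^sub>F n in sequentially. 2 * e * ?v (n + M) < 3 * e * ?v n"
    using \<open>e > 0\<close> by (intro eventually_vol_shift_less) simp
  with A have "\<exists>\<^sub>F n in sequentially.
      2 * e * ?v (n + M) < 3 * e * ?v n \<and> a * ?v n \<le> real (card (A \<inter> cube n))"
    by (rule frequently_eventually_conj)
  then have "\<exists>\<^sub>F n in sequentially. (a - 3 * e) * ?v n \<le> real (card (G \<inter> cube (n + (M + L))))"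
  proof (rule frequently_elim1)
    fix n assume "2 * e * ?v (n + M) < 3 * e * ?v n \<and> a * ?v n \<le> real (card (A \<inter> cube n))"
    then show "(a - 3 * e) * ?v n \<le> real (card (G \<inter> cube (n + (M + L))))"
      using bound[of n] unfolding left_diff_distrib by linarith
  qed
  then show ?thesis unfolding G_def by blast
qed

section \<open>Sets whose density is not raised by fattening\<close>

text \<open>A point of \<open>A\<close> whose \<open>k\<close>-cube leaves \<open>A\<close> is
  within \<open>cube k\<close> of a point gained by fattening. Such gains are sparse at radii where
  \<open>A\<close> nearly reaches density \<open>a\<close>, so most points of \<open>A\<close> carry
  a whole cube inside \<open>A\<close>; translating by \<open>b\<close> preserves this.\<close>

lemma upper_density_cubes_in_self_translate:
  fixes A :: "(int ^ 'd) set"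
  assumes A: "upper_density A = ereal a" and fat: "upper_density (A + cube k) \<le> ereal a"
  shows "ereal a \<le> upper_density {z. (+) z ` cube k \<subseteq> (+) b ` A}"
proof (rule upper_density_geI)
  fix r assume "r < a"
  let ?v = "vol CARD('d)"
  let ?G = "{z. (+) z ` cube k \<subseteq> (+) b ` A}"
  \<comment> \<open>The losses are \<open>e\<close> in the density of \<open>A\<close> and
    \<open>3 * e * ?v k\<close> from exceptional points; this \<open>e\<close> keeps their sum below
    \<open>a - r\<close>.\<close>
  define e where "e = (a - r) / (2 + 3 * ?v k)"
  have e: "e > 0" "a - e - 3 * e * ?v k \<ge> r"
  proof -
    show "e > 0" using \<open>r < a\<close> vol_pos[of "CARD('d)" k] by (simp add: e_def)
    have "e * (2 + 3 * ?v k) = a - r" using vol_pos[of "CARD('d)" k] by (simp add: e_def)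
    then show "a - e - 3 * e * ?v k \<ge> r" using \<open>e > 0\<close> by (simp add: algebra_simps)
  qed
  obtain L where L: "b \<in> cube L" using ex_in_cube by blast
  have bound: "real (card (A \<inter> cube n)) \<le> real (card (?G \<inter> cube (n + L)))
      + ?v k * (real (card ((A + cube k) \<inter> cube (n + k))) - real (card (A \<inter> cube n)))" for n
  proof -
    let ?X = "{z \<in> A \<inter> cube n. (+) z ` cube k \<subseteq> A}"
    \<comment> \<open>Removing only \<open>A \<inter> cube n\<close>, not all of \<open>A\<close>,
      makes the size of \<open>?Z\<close> exactly a difference of two counts that the densities
      control.\<close>
    let ?Z = "((A + cube k) \<inter> cube (n + k)) - A \<inter> cube n"
    \<comment> \<open>An exceptional \<open>z\<close> is recovered as \<open>p - y\<close> from
      \<open>p = z + y\<close> in \<open>?Z\<close>, so there are at most \<open>card ?Z\<close>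
      times the volume of \<open>cube k\<close> of them.\<close>
    have "A \<inter> cube n \<subseteq> ?X \<union> (\<lambda>(p, y). p - y) ` (?Z \<times> cube k)"
    proof
      fix z assume z: "z \<in> A \<inter> cube n"
      show "z \<in> ?X \<union> (\<lambda>(p, y). p - y) ` (?Z \<times> cube k)"
      proof (cases "(+) z ` cube k \<subseteq> A")
        case False
        then obtain y where y: "y \<in> cube k" "z + y \<notin> A" by auto
        then have "z + y \<in> ?Z" using z by (auto intro: add_in_cube)
        then show ?thesis using y by (intro UnI2 image_eqI[of _ _ "(z + y, y)"]) auto
      qed (use z in auto)
    qed
    then have "card (A \<inter> cube n) \<le> card (?X \<union> (\<lambda>(p, y). p - y) ` (?Z \<times> cube k))"
      by (intro card_mono) auto
    also have "\<dots> \<le> card ?X + card ((\<lambda>(p, y). p - y) ` (?Z \<times> cube k))"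
      by (rule card_Un_le)
    also have "card ((\<lambda>(p, y). p - y) ` (?Z \<times> cube k)) \<le> card (?Z \<times> (cube k :: (int ^ 'd) set))"
      by (rule card_image_le) auto
    finally have "real (card (A \<inter> cube n)) \<le> real (card ?X) + real (card ?Z) * ?v k"
      using of_nat_mono by (fastforce simp: card_cartesian_product card_cube[symmetric])
    moreover have "real (card ?Z) = real (card ((A + cube k) \<inter> cube (n + k))) - real (card (A \<inter> cube n))"
    proof -
      have "A \<inter> cube n \<subseteq> (A + cube k) \<inter> cube (n + k)"
        using subset_plus_cube cube_mono[of n "n + k"] by fastforce
      then show ?thesis
        by (subst card_Diff_subset) (auto intro!: of_nat_diff card_mono)
    qed
    moreover have "card ?X \<le> card (?G \<inter> cube (n + L))"
    proof (rule card_inj_on_le[of "(+) b"])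
      show "(+) b ` ?X \<subseteq> ?G \<inter> cube (n + L)"
      proof clarify
        fix z assume z: "z \<in> A" "z \<in> cube n" "(+) z ` cube k \<subseteq> A"
        have "b + z + y \<in> (+) b ` A" if "y \<in> cube k" for y
          using z(3) that by (auto simp: add.assoc)
        moreover have "b + z \<in> cube (n + L)"
          using add_in_cube[OF z(2) L] by (simp add: add.commute)
        ultimately show "b + z \<in> ?G \<inter> cube (n + L)" by auto
      qed
    qed auto
    ultimately show ?thesis by (simp add: mult.commute)
  qed
  \<comment> \<open>The limsup gives the lower bound for \<open>A\<close> only infinitely often, but
    the upper bound for its fattening holds for all large \<open>n\<close>; hence both hold at
    common radii, with a gap of \<open>3 * e\<close>.\<close>
  have freq: "\<exists>\<^sub>F n in sequentially. (a - e) * ?v n \<le> real (card (A \<inter> cube n))"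
    using A e by (intro frequently_of_less_upper_density) simp
  have ev1: "\<forall>\<^sub>F n in sequentially. real (card ((A + cube k) \<inter> cube (n + k))) < (a + e) * ?v (n + k)"
  proof (subst eventually_sequentially_seg, rule eventually_of_upper_density_less)
    have "ereal a < ereal (a + e)" using e(1) by simp
    with fat show "upper_density (A + cube k) < ereal (a + e)" by (rule order_le_less_trans)
  qed
  have ev2: "\<forall>\<^sub>F n in sequentially. (a + e) * ?v (n + k) < (a + 2 * e) * ?v n"
    using e by (intro eventually_vol_shift_less) simp
  from frequently_eventually_conj[OF freq eventually_conj[OF ev1 ev2]]
  have "\<exists>\<^sub>F n in sequentially. (a - e) * ?v n \<le> real (card (A \<inter> cube n)) \<and>
     real (card ((A + cube k) \<inter> cube (n + k))) < (a + e) * ?v (n + k) \<and>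
     (a + e) * ?v (n + k) < (a + 2 * e) * ?v n"
    by (rule frequently_elim1) blast
  then have "\<exists>\<^sub>F n in sequentially. r * ?v n \<le> real (card (?G \<inter> cube (n + L)))"
  proof (rule frequently_elim1)
    fix n
    assume n: "(a - e) * ?v n \<le> real (card (A \<inter> cube n)) \<and>
      real (card ((A + cube k) \<inter> cube (n + k))) < (a + e) * ?v (n + k) \<and>
      (a + e) * ?v (n + k) < (a + 2 * e) * ?v n"
    then have "real (card ((A + cube k) \<inter> cube (n + k))) - real (card (A \<inter> cube n)) \<le> 3 * e * ?v n"
      by (simp add: algebra_simps)
    then have "?v k * (real (card ((A + cube k) \<inter> cube (n + k))) - real (card (A \<inter> cube n)))
        \<le> ?v k * (3 * e * ?v n)"
      using vol_pos[of "CARD('d)" k] by (intro mult_left_mono) auto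
    then have "(a - e) * ?v n - ?v k * (3 * e * ?v n) \<le> real (card (?G \<inter> cube (n + L)))"
      using bound[of n] n by linarith
    moreover have "r * ?v n \<le> (a - e - 3 * e * ?v k) * ?v n"
      using e(2) vol_pos[of "CARD('d)" n] by (intro mult_right_mono) auto
    ultimately show "r * ?v n \<le> real (card (?G \<inter> cube (n + L)))"
      by (simp add: algebra_simps)
  qed
  then show "\<exists>K. \<exists>\<^sub>F n in sequentially. r * ?v n \<le> real (card (?G \<inter> cube (n + K)))" ..
qed

section \<open>Conclusion, by cases on whether fattening raises the density of
  \<open>A\<close>\<close>

lemma upper_density_mono:
  fixes A B :: "(int ^ 'd) set"
  assumes "A \<subseteq> B"
  shows "upper_density A \<le> upper_density B"
  unfolding upper_density_def
proof (rule Limsup_mono, rule always_eventually, rule allI)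
  fix n
  have "card (A \<inter> cube n) \<le> card (B \<inter> cube n)" using assms by (intro card_mono) auto
  then show "ereal (real (card (A \<inter> cube n)) / real ((2 * n + 1) ^ CARD('d)))
      \<le> ereal (real (card (B \<inter> cube n)) / real ((2 * n + 1) ^ CARD('d)))"
    by (simp add: divide_right_mono)
qed

theorem theorem3p4:
  fixes A B :: "(int ^ 'd) set" and \<alpha> :: real
  assumes "upper_density A = ereal \<alpha>" and "\<alpha> > 0" and "banach_density B > 0"
  shows "upper_syndetic \<alpha> (A + B)"
proof -
  obtain r where r: "r > 0" "dense_windows B r"
    using dense_windows_of_banach_density[OF assms(3)] .
  have "\<exists>m. \<forall>k\<ge>1. upper_density {z. (+) z ` cube k \<subseteq> A + B + cube m} \<ge> ereal \<alpha>"
  proof (cases "\<exists>m. ereal \<alpha> < upper_density (A + cube m)")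
    case True
    then obtain m a where a: "\<alpha> < a" "ereal a < upper_density (A + cube m)"
      using ereal_dense2 by (metis ereal_less_eq(3) linorder_not_le)
    \<comment> \<open>\<open>frequently_cubes_in_sum\<close> loses \<open>3 * e\<close>, which
      brings \<open>a\<close> down to exactly \<alpha>.\<close>
    define e where "e = (a - \<alpha>) / 3"
    have e: "e > 0" "a - 3 * e = \<alpha>" using a by (simp_all add: e_def field_simps)
    obtain m' where m': "dense_windows (B + cube m') (1 - e)"
      using dense_windows_plus_cube[OF r(2,1) e(1)] by blast
    \<comment> \<open>Both \<open>m\<close> and \<open>m'\<close> were fixed before
      \<open>k\<close>, so one fattening of \<open>A + B\<close> serves every
      \<open>k\<close>.\<close>
    have "ereal \<alpha> \<le> upper_density {z. (+) z ` cube k \<subseteq> A + B + cube (m + m')}" for k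
    proof -
      obtain K where K: "\<exists>\<^sub>F n in sequentially. \<alpha> * vol CARD('d) n
          \<le> real (card ({z. (+) z ` cube k \<subseteq> (A + cube m) + (B + cube m')} \<inter> cube (n + K)))"
        using frequently_cubes_in_sum[OF frequently_of_less_upper_density[OF a(2)] m' e(1), of k] e
        by auto
      have "ereal \<alpha> \<le> upper_density {z. (+) z ` cube k \<subseteq> (A + cube m) + (B + cube m')}"
      proof (rule upper_density_geI)
        fix q assume "q < \<alpha>"
        then have "q * vol CARD('d) n \<le> \<alpha> * vol CARD('d) n" for n
          using vol_pos[of "CARD('d)" n] by simp
        then show "\<exists>K. \<exists>\<^sub>F n in sequentially. q * vol CARD('d) n
          \<le> real (card ({z. (+) z ` cube k \<subseteq> (A + cube m) + (B + cube m')} \<inter> cube (n + K)))"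
          by (intro exI[of _ K] frequently_elim1[OF K]) (rule order_trans)
      qed
      also have "\<dots> \<le> upper_density {z. (+) z ` cube k \<subseteq> A + B + cube (m + m')}"
        using plus_cube_plus_plus_cube[of A m B m'] by (intro upper_density_mono) blast
      finally show ?thesis .
    qed
    then show ?thesis by blast
  next
    case False
    have "B \<noteq> {}"
    proof
      assume "B = {}"
      then obtain n where "r * vol CARD('d) n \<le> 0"
        using frequently_ex[OF r(2)[unfolded dense_windows_def]] by auto
      then show False using r(1) vol_pos[of "CARD('d)" n] by (simp add: mult_le_0_iff)
    qed
    then obtain b where b: "b \<in> B" by blast
    \<comment> \<open>Here \<open>m = 0\<close> is the witness: a single translate of
      \<open>A\<close> inside \<open>A + B\<close> already contains the required cubes.\<close>
    have "(+) b ` A \<subseteq> A + B + cube 0"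
      using b subset_plus_cube[of "A + B" 0] by (auto simp: add.commute[of b])
    then have "upper_density {z. (+) z ` cube k \<subseteq> (+) b ` A}
        \<le> upper_density {z. (+) z ` cube k \<subseteq> A + B + cube 0}" for k
      by (intro upper_density_mono) blast
    moreover have "ereal \<alpha> \<le> upper_density {z. (+) z ` cube k \<subseteq> (+) b ` A}" for k
      using False by (intro upper_density_cubes_in_self_translate[OF assms(1)]) (simp add: not_less)
    ultimately show ?thesis by (meson order_trans)
  qed
  moreover have "\<alpha> \<le> 1"
    using upper_density_le_1[of A] assms(1) by simp
  ultimately show ?thesis
    using assms(2) by (simp add: upper_syndetic_def)
qed

end
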